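(* Let $f:\mathbb{R}^n\to \mathbb{R}$ be directed subdifferentiable at $\widehat{x}\in\mathbb{R}^n$. If $\widehat{x}$ is a local minimum of $f$, then $$\overrightarrow{0} \leq \overrightarrow{\partial} f(\widehat{x}),$$ whereas if $\widehat x$ is a local maximum of $f$, then $$\overrightarrow{0} \leq -\overrightarrow{\partial} f(\widehat{x}).$$
   Context: Notation. $\mathcal{S}_{n-1}$ is the Euclidean unit sphere in $\mathbb{R}^n$ (so $\mathcal{S}_0=\{-1,1\}$). The (Dini) directional derivative of $f:\mathbb{R}^n\to\mathbb{R}$ at $x$ in direction $l$ is $f'(x;l)=\lim_{t\downarrow 0}\frac{f(x+tl)-f(x)}{t}$. For $n\ge 2$ and $l\in\mathcal{S}_{n-1}$, $\Pi_{n-1,l}:\mathbb{R}^n\to\mathbb{R}^{n-1}$ is a fixed linear map that maps the orthogonal complement of $l$ isometrically onto $\mathbb{R}^{n-1}$ and maps $l$ to $0$; its transpose $\Pi_{n-1,l}^\top:\mathbb{R}^{n-1}\to\mathbb{R}^n$ maps $\mathbb{R}^{n-1}$ onto the orthogonal complement of $l$ and inverts the restriction of $\Pi_{n-1,l}$ to that complement. Directed subdifferentiable functions. A function $f:\mathbb{R}\to\mathbb{R}$ is $M$-directed subdifferentiable at $x\in\mathbb{R}$ if $f'(x;1)$ and $f'(x;-1)$ exist and $\max\{|f'(x;-1)|,|f'(x;1)|\}\le M$. A function $f:\mathbb{R}^n\to\mathbb{R}$, $n\ge2$, is $M$-directed subdifferentiable at $x\in\mathbb{R}^n$ if $f'(x;l)$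 exists for every $l$, is continuous as a function of $l$, satisfies $\max_{l\in\mathcal{S}_{n-1}}|f'(x;l)|\le M$, and for every $l\in\mathcal{S}_{n-1}$ the function $f_l:\mathbb{R}^{n-1}\to\mathbb{R}$, $f_l(\cdot)=f'(x;l+\Pi_{n-1,l}^\top(\cdot))$, is $M$-directed subdifferentiable at $0_{n-1}$. $f$ is directed subdifferentiable at $x$ if it is $M$-directed subdifferentiable at $x$ for some $M\ge 0$. Directed sets. For $n=1$ a directed set is a directed interval $\overrightarrow{[a,b]}$ with $a,b\in\mathbb{R}$ arbitrary, identified with the pair $(a_1(-1),a_1(1))=(-a,b)$; its norm is $\max\{|a_1(-1)|,|a_1(1)|\}$. For $n\ge2$ a directed set is a family $\overrightarrow{A}=(\overrightarrow{A_{n-1}(l)},a_n(l))_{l\in\mathcal{S}_{n-1}}$ with $a_n:\mathcal{S}_{n-1}\to\mathbb{R}$ continuous and $l\mapsto\overrightarrow{A_{n-1}(l)}$ a map into $(n-1)$-dimensional directed sets, uniformly bounded in norm; its norm is $\max\{\sup_l\|\overrightarrow{A_{n-1}(l)}\|,\max_l|a_n(l)|\}$. The negative is taken componentwise: $-\overrightarrow{[a,b]}=\overrightarrow{[-a,-b]}$ and, for $n\ge 2$, $-\overrightarrow{A}=(-\overrightarrow{A_{n-1}(l)},-a_n(l))_{l}$. Directed zero: $\overrightarrow{0}_1=\overrightarrow{[0,0]}$ and $\overrightarrow{0}_n=(\overrightarrow{0}_{n-1},0)_{l\in\mathcal{S}_{n-1}}$ for $n>1$; $\overrightarrow{0}$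 stands for $\overrightarrow{0}_n$. Partial order: for $n$-dimensional directed sets, $\overrightarrow{A}\le\overrightarrow{B}$ means (i) $a_n(l)\le b_n(l)$ for every $l\in\mathcal{S}_{n-1}$, and (ii) whenever $n\ge2$ and $a_n(l)=b_n(l)$, one has $\overrightarrow{A_{n-1}(l)}\le\overrightarrow{B_{n-1}(l)}$. Directed subdifferential. For $f$ directed subdifferentiable at $x$: if $n=1$, $\overrightarrow{\partial} f(x)=\overrightarrow{[-f'(x;-1),f'(x;1)]}=(f'(x;l))_{l=\pm1}$; if $n\ge2$, $\overrightarrow{\partial} f(x)=(\overrightarrow{\partial} f_l(0),f'(x;l))_{l\in\mathcal{S}_{n-1}}$ with $f_l(\cdot)=f'(x;l+\Pi_{n-1,l}^\top(\cdot))$. *)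

theory Defs
  imports "HOL-Analysis.Analysis"
begin

text \<open>
  The dimension varies inside the recursive notions below, so $R^n$ is \<^term>\<open>Euclidean_space n\<close>
  (sequences of reals vanishing from index \<open>n\<close> on) and $S_{n-1}$ is \<^term>\<open>nsphere (n - 1)\<close>.
  A function on $R^n$ is a function on \<^typ>\<open>nat \<Rightarrow> real\<close>, of which only the values at points of
  $R^n$ are ever used.
\<close>

type_synonym point = "nat \<Rightarrow> real"

abbreviation space_E :: "nat \<Rightarrow> point set"
  where "space_E n \<equiv> topspace (Euclidean_space n)"

abbreviation sphere_E :: "nat \<Rightarrow> point set"
  where "sphere_E m \<equiv> topspace (nsphere m)"

definition point1 :: "real \<Rightarrow> point"
  where "point1 s = (\<lambda>i. if i = 0 then s else 0)"


section \<open>Projections along a direction\<close>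

text \<open>\<open>P m l\<close> is the linear map $\Pi_{m,l}$ from $R^{m+1}$ to $R^m$, for \<open>m \<ge> 1\<close> and \<open>l\<close> in $S_m$.\<close>

definition orth_compl :: "nat \<Rightarrow> point \<Rightarrow> point set"
  where "orth_compl n l = {u \<in> space_E n. (\<Sum>i<n. u i * l i) = 0}"

definition is_projection :: "nat \<Rightarrow> point \<Rightarrow> (point \<Rightarrow> point) \<Rightarrow> bool"
  where "is_projection m l p \<longleftrightarrow>
    p ` space_E (Suc m) \<subseteq> space_E m \<and>
    (\<forall>u\<in>space_E (Suc m). \<forall>v\<in>space_E (Suc m). \<forall>a b.
       p (\<lambda>i. a * u i + b * v i) = (\<lambda>i. a * p u i + b * p v i)) \<and>
    p l = (\<lambda>i. 0) \<and>
    p ` orth_compl (Suc m) l = space_E m \<and>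
    (\<forall>u\<in>orth_compl (Suc m) l. sqrt (\<Sum>i<m. (p u i)\<^sup>2) = sqrt (\<Sum>i<Suc m. (u i)\<^sup>2))"

definition projection_family :: "(nat \<Rightarrow> point \<Rightarrow> point \<Rightarrow> point) \<Rightarrow> bool"
  where "projection_family P \<longleftrightarrow> (\<forall>m\<ge>1. \<forall>l\<in>sphere_E m. is_projection m l (P m l))"

text \<open>The matrix of \<open>P m l\<close> has entry \<open>P m l e\<^sub>j i\<close> in row \<open>i < m\<close> and column \<open>j \<le> m\<close>.\<close>

definition proj_transpose :: "(nat \<Rightarrow> point \<Rightarrow> point \<Rightarrow> point) \<Rightarrow> nat \<Rightarrow> point \<Rightarrow> point \<Rightarrow> point"
  where "proj_transpose P m l y =
    (\<lambda>j. if j \<le> m then \<Sum>i<m. P m l (\<lambda>k. if k = j then 1 else 0) i * y i else 0)"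


section \<open>Directed subdifferentiable functions\<close>

definition dir_quotient :: "(point \<Rightarrow> real) \<Rightarrow> point \<Rightarrow> point \<Rightarrow> real \<Rightarrow> real"
  where "dir_quotient f x l t = (f (\<lambda>i. x i + t * l i) - f x) / t"

definition dir_differentiable :: "(point \<Rightarrow> real) \<Rightarrow> point \<Rightarrow> point \<Rightarrow> bool"
  where "dir_differentiable f x l \<longleftrightarrow> (\<exists>D. (dir_quotient f x l \<longlongrightarrow> D) (at_right 0))"

definition dir_deriv :: "(point \<Rightarrow> real) \<Rightarrow> point \<Rightarrow> point \<Rightarrow> real"
  where "dir_deriv f x l = Lim (at_right 0) (dir_quotient f x l)"

text \<open>\<open>dir_slice P m f x l\<close> is $f_l$ on $R^m$, for \<open>f\<close> on $R^{m+1}$.\<close>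

definition dir_slice ::
    "(nat \<Rightarrow> point \<Rightarrow> point \<Rightarrow> point) \<Rightarrow> nat \<Rightarrow> (point \<Rightarrow> real) \<Rightarrow> point \<Rightarrow> point \<Rightarrow> point \<Rightarrow> real"
  where "dir_slice P m f x l = (\<lambda>y. dir_deriv f x (\<lambda>i. l i + proj_transpose P m l y i))"

text \<open>The dimension is at least 1 throughout; dimension 0 only gets default values.\<close>

fun directed_subdiff_bound ::
    "(nat \<Rightarrow> point \<Rightarrow> point \<Rightarrow> point) \<Rightarrow> nat \<Rightarrow> real \<Rightarrow> (point \<Rightarrow> real) \<Rightarrow> point \<Rightarrow> bool"
  where
    "directed_subdiff_bound P 0 M f x \<longleftrightarrow> False"
  | "directed_subdiff_bound P (Suc 0) M f x \<longleftrightarrow>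
       dir_differentiable f x (point1 1) \<and> dir_differentiable f x (point1 (-1)) \<and>
       max \<bar>dir_deriv f x (point1 (-1))\<bar> \<bar>dir_deriv f x (point1 1)\<bar> \<le> M"
  | "directed_subdiff_bound P (Suc (Suc m)) M f x \<longleftrightarrow>
       (\<forall>l\<in>space_E (Suc (Suc m)). dir_differentiable f x l) \<and>
       continuous_map (Euclidean_space (Suc (Suc m))) euclideanreal (dir_deriv f x) \<and>
       (\<forall>l\<in>sphere_E (Suc m). \<bar>dir_deriv f x l\<bar> \<le> M) \<and>
       (\<forall>l\<in>sphere_E (Suc m).
          directed_subdiff_bound P (Suc m) M (dir_slice P (Suc m) f x l) (\<lambda>i. 0))"

definition directed_subdifferentiable ::
    "(nat \<Rightarrow> point \<Rightarrow> point \<Rightarrow> point) \<Rightarrow> nat \<Rightarrow> (point \<Rightarrow> real) \<Rightarrow> point \<Rightarrow> bool"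
  where "directed_subdifferentiable P n f x \<longleftrightarrow> (\<exists>M\<ge>0. directed_subdiff_bound P n M f x)"


section \<open>Directed sets\<close>

text \<open>
  \<open>Interval a b\<close> is the directed interval, i.e. the pair $(a_1(-1), a_1(1)) = (-a, b)$, and
  \<open>Family A a\<close> is the family $(A(l), a(l))_l$. Values of \<open>A\<close> and \<open>a\<close> off the sphere are
  disregarded, so that HOL equality is finer than equality of directed sets.
\<close>

datatype directed = Interval real real | Family "point \<Rightarrow> directed" "point \<Rightarrow> real"

fun directed_norm :: "nat \<Rightarrow> directed \<Rightarrow> real"
  where
    "directed_norm (Suc 0) (Interval a b) = max \<bar>- a\<bar> \<bar>b\<bar>"
  | "directed_norm (Suc (Suc m)) (Family A a) =
       max (SUP l\<in>sphere_E (Suc m). directed_norm (Suc m) (A l)) (SUP l\<in>sphere_E (Suc m). \<bar>a l\<bar>)"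
  | "directed_norm _ _ = 0"

fun directed_set :: "nat \<Rightarrow> directed \<Rightarrow> bool"
  where
    "directed_set (Suc 0) (Interval a b) \<longleftrightarrow> True"
  | "directed_set (Suc (Suc m)) (Family A a) \<longleftrightarrow>
       continuous_map (nsphere (Suc m)) euclideanreal a \<and>
       (\<forall>l\<in>sphere_E (Suc m). directed_set (Suc m) (A l)) \<and>
       bdd_above ((\<lambda>l. directed_norm (Suc m) (A l)) ` sphere_E (Suc m))"
  | "directed_set _ _ \<longleftrightarrow> False"

primrec directed_uminus :: "directed \<Rightarrow> directed"
  where
    "directed_uminus (Interval a b) = Interval (- a) (- b)"
  | "directed_uminus (Family A a) = Family (\<lambda>l. directed_uminus (A l)) (\<lambda>l. - a l)"

fun directed_zero :: "nat \<Rightarrow> directed"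
  where
    "directed_zero (Suc (Suc m)) = Family (\<lambda>l. directed_zero (Suc m)) (\<lambda>l. 0)"
  | "directed_zero _ = Interval 0 0"

fun directed_le :: "nat \<Rightarrow> directed \<Rightarrow> directed \<Rightarrow> bool"
  where
    "directed_le (Suc 0) (Interval a b) (Interval c d) \<longleftrightarrow> - a \<le> - c \<and> b \<le> d"
  | "directed_le (Suc (Suc m)) (Family A a) (Family B b) \<longleftrightarrow>
       (\<forall>l\<in>sphere_E (Suc m). a l \<le> b l) \<and>
       (\<forall>l\<in>sphere_E (Suc m). a l = b l \<longrightarrow> directed_le (Suc m) (A l) (B l))"
  | "directed_le _ _ _ \<longleftrightarrow> False"

fun directed_subdiff ::
    "(nat \<Rightarrow> point \<Rightarrow> point \<Rightarrow> point) \<Rightarrow> nat \<Rightarrow> (point \<Rightarrow> real) \<Rightarrow> point \<Rightarrow> directed"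
  where
    "directed_subdiff P (Suc (Suc m)) f x =
       Family (\<lambda>l. directed_subdiff P (Suc m) (dir_slice P (Suc m) f x l) (\<lambda>i. 0)) (dir_deriv f x)"
  | "directed_subdiff P _ f x = Interval (- dir_deriv f x (point1 (-1))) (dir_deriv f x (point1 1))"


section \<open>Local extrema\<close>

definition local_minimum :: "nat \<Rightarrow> (point \<Rightarrow> real) \<Rightarrow> point \<Rightarrow> bool"
  where "local_minimum n f x \<longleftrightarrow> (\<forall>\<^sub>F y in nhdsin (Euclidean_space n) x. f x \<le> f y)"

definition local_maximum :: "nat \<Rightarrow> (point \<Rightarrow> real) \<Rightarrow> point \<Rightarrow> bool"
  where "local_maximum n f x \<longleftrightarrow> (\<forall>\<^sub>F y in nhdsin (Euclidean_space n) x. f y \<le> f x)"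


section \<open>Well-definedness\<close>

lemma sphere_E_nonempty: "sphere_E m \<noteq> {}"
  using in_topspace_nsphere by blast

lemma directed_zero_is_directed: "n \<ge> 1 \<Longrightarrow> directed_set n (directed_zero n)"
  by (induction n rule: directed_zero.induct) auto

lemma directed_norm_uminus: "directed_norm n (directed_uminus A) = directed_norm n A"
  by (induction n A rule: directed_norm.induct) (auto cong: SUP_cong)

lemma directed_uminus_is_directed: "directed_set n A \<Longrightarrow> directed_set n (directed_uminus A)"
  by (induction n A rule: directed_set.induct)
    (auto simp: directed_norm_uminus intro: continuous_map_minus)

lemma directed_subdiff_is_directed:
  assumes "directed_subdiff_bound P n M f x"
  shows "directed_set n (directed_subdiff P n f x) \<and> directed_norm n (directed_subdiff P n f x) \<le> M"
  using assms
proof (induction P n M f x rule: directed_subdiff_bound.induct)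
  case (3 P m M f x)
  have sub: "continuous_map (nsphere (Suc m)) euclideanreal (dir_deriv f x)"
    using 3 unfolding nsphere_def by (auto intro: continuous_map_from_subtopology)
  show ?case
    using 3 sub by (auto intro!: cSUP_least sphere_E_nonempty bdd_aboveI2[where M = M])
qed auto


text \<open>Projections exist: apply the reflection taking \<open>l\<close> to the last unit vector, then drop the
  last coordinate.\<close>

lemma is_projection_exists:
  assumes l: "l \<in> sphere_E m"
  shows "\<exists>p. is_projection m l p"
proof -
  define S :: "(nat \<Rightarrow> real) \<Rightarrow> real" where "S g = (\<Sum>i<Suc m. g i)" for g
  define w where "w i = l i - (if i = m then 1 else 0)" for i
  define W where "W = S (\<lambda>i. w i * w i)"
  define c where "c = 2 / W"
  define H where "H u i = u i - c * S (\<lambda>i. u i * w i) * w i" for u i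
  define p where "p u i = (if i < m then H u i else 0)" for u i
  have S_add: "S (\<lambda>i. g i + h i) = S g + S h" for g h by (simp add: S_def sum.distrib)
  have S_diff: "S (\<lambda>i. g i - h i) = S g - S h" for g h by (simp add: S_def sum_subtractf)
  have S_mult: "S (\<lambda>i. a * g i) = a * S g" for a g unfolding S_def by (simp only: sum_distrib_left)
  have l0: "l i = 0" if "i > m" for i using l that by (simp add: nsphere)
  have ll: "S (\<lambda>i. l i * l i) = 1"
    using l by (simp add: nsphere S_def lessThan_Suc_atMost power2_eq_square)
  have uw: "S (\<lambda>i. u i * w i) = S (\<lambda>i. u i * l i) - u m" for u
  proof -
    have "S (\<lambda>i. u i * w i) = S (\<lambda>i. u i * l i - (if i = m then u i else 0))"
      unfolding w_def by (rule arg_cong[where f = S]) (auto simp: algebra_simps)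
    then show ?thesis by (simp add: S_diff) (simp add: S_def)
  qed
  have W: "W = 2 * (1 - l m)"
  proof -
    have "S (\<lambda>i. l i * w i) = 1 - l m" by (simp add: uw ll)
    moreover have "S (\<lambda>i. w i * l i) = S (\<lambda>i. l i * w i)" by (simp add: mult.commute)
    ultimately show ?thesis unfolding W_def uw[of w] by (simp add: w_def)
  qed
  have wz: "w i = 0" if "W = 0" for i
  proof (cases "i \<le> m")
    case True
    have "\<forall>j\<in>{..<Suc m}. w j * w j = 0"
      using that unfolding W_def S_def by (subst (asm) sum_nonneg_eq_0_iff) auto
    then show ?thesis using True by auto
  qed (auto simp: w_def l0)
  have cW: "c * (1 - l m) = 1" if "W \<noteq> 0"
    using that W unfolding c_def by (simp add: field_simps)
  have Hl: "H l i = (if i = m then 1 else 0)" for i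
  proof (cases "W = 0")
    case True
    then show ?thesis using wz[of i] by (simp add: H_def w_def split: if_splits)
  next
    case False
    have "H l i = l i - w i" unfolding H_def uw ll by (simp add: cW[OF False])
    then show ?thesis by (simp add: w_def)
  qed
  have lin: "H (\<lambda>i. a * u i + b * v i) i = a * H u i + b * H v i" for a b u v i
  proof -
    have "S (\<lambda>i. (a * u i + b * v i) * w i) = a * S (\<lambda>i. u i * w i) + b * S (\<lambda>i. v i * w i)"
      by (simp add: S_add S_mult distrib_right mult.assoc)
    then show ?thesis by (simp add: H_def algebra_simps)
  qed
  have Hw: "S (\<lambda>i. H u i * w i) = - S (\<lambda>i. u i * w i)" for u
  proof -
    have "S (\<lambda>i. H u i * w i) = S (\<lambda>i. u i * w i) - c * S (\<lambda>i. u i * w i) * W"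
      by (simp add: H_def W_def left_diff_distrib S_diff S_mult mult.assoc)
    moreover have "S (\<lambda>i. u i * w i) = 0" if "W = 0" using wz[OF that] by (simp add: S_def)
    ultimately show ?thesis by (cases "W = 0") (auto simp: c_def)
  qed
  have HH: "H (H u) i = u i" for u i
    unfolding H_def[of "H u"] Hw by (simp add: H_def)
  have Hm: "H u m = S (\<lambda>i. u i * l i)" for u
  proof (cases "W = 0")
    case True
    then have "w m = 0" "S (\<lambda>i. u i * w i) = 0" using wz[OF True] by (auto simp: S_def)
    then show ?thesis using uw[of u] by (simp add: H_def)
  next
    case False
    have "H u m = u m + S (\<lambda>i. u i * w i) * (c * (1 - l m))"
      by (simp add: H_def w_def algebra_simps)
    then show ?thesis using cW[OF False] uw[of u] by simp
  qed
  have iso: "S (\<lambda>i. (H u i)\<^sup>2) = S (\<lambda>i. (u i)\<^sup>2)" for u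
  proof -
    let ?s = "S (\<lambda>i. u i * w i)"
    have "S (\<lambda>i. (H u i)\<^sup>2) = S (\<lambda>i. (u i * u i - c * ?s * (u i * w i)) - c * ?s * (H u i * w i))"
      by (rule arg_cong[where f = S]) (auto simp: H_def power2_eq_square algebra_simps)
    also have "\<dots> = S (\<lambda>i. u i * u i) - c * ?s * ?s - c * ?s * S (\<lambda>i. H u i * w i)"
      by (simp only: S_diff S_mult)
    finally show ?thesis by (simp add: Hw power2_eq_square)
  qed
  have H0: "H u i = 0" if "u \<in> space_E (Suc m)" "i > m" for u i
    using that by (simp add: H_def w_def l0 topspace_Euclidean_space)
  have orth: "u \<in> orth_compl (Suc m) l \<longleftrightarrow> u \<in> space_E (Suc m) \<and> H u m = 0" for u
    by (simp add: orth_compl_def Hm S_def)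
  have "is_projection m l p"
    unfolding is_projection_def
  proof (intro conjI ballI allI)
    show "p ` space_E (Suc m) \<subseteq> space_E m" by (auto simp: p_def topspace_Euclidean_space)
    show "p (\<lambda>i. a * u i + b * v i) = (\<lambda>i. a * p u i + b * p v i)" for u v a b
      by (auto simp: p_def lin)
    show "p l = (\<lambda>i. 0)" by (auto simp: p_def Hl)
    show "p ` orth_compl (Suc m) l = space_E m"
    proof
      show "p ` orth_compl (Suc m) l \<subseteq> space_E m" by (auto simp: p_def topspace_Euclidean_space)
      show "space_E m \<subseteq> p ` orth_compl (Suc m) l"
      proof
        fix y assume "y \<in> space_E m"
        then have y: "y i = 0" if "i \<ge> m" for i using that by (simp add: topspace_Euclidean_space)
        then have ys: "y \<in> space_E (Suc m)" by (simp add: topspace_Euclidean_space)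
        have "H y \<in> orth_compl (Suc m) l"
          unfolding orth HH using y H0[OF ys] by (simp add: topspace_Euclidean_space)
        moreover have "p (H y) = y" using y by (auto simp: p_def HH fun_eq_iff)
        ultimately show "y \<in> p ` orth_compl (Suc m) l" by (metis imageI)
      qed
    qed
    show "sqrt (\<Sum>i<m. (p u i)\<^sup>2) = sqrt (\<Sum>i<Suc m. (u i)\<^sup>2)" if "u \<in> orth_compl (Suc m) l" for u
      using iso[of u] that by (simp add: orth p_def S_def)
  qed
  then show ?thesis by (rule exI[of _ p])
qed

lemma projection_family_exists: "\<exists>P. projection_family P"
proof
  show "projection_family (\<lambda>m l. SOME p. is_projection m l p)"
    unfolding projection_family_def
  proof (intro allI ballI impI)
    fix m l assume "l \<in> sphere_E m"
    from is_projection_exists[OF this] show "is_projection m l (SOME p. is_projection m l p)"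
      by (rule someI_ex)
  qed
qed

end

theory Submission
  imports Defs
begin

text \<open>
  Along every ray from a local minimum the difference quotients are eventually nonnegative, so
  $f'(x;l) \ge 0$ for all $l$. Where $f'(x;l) = 0$, this says that $f_l \ge 0 = f_l(0)$ on all of
  $R^{n-1}$, so $0$ is a minimum of $f_l$ and one concludes by induction on the dimension.
\<close>

text \<open>The ray from \<open>x\<close> along \<open>l\<close> is a continuous map into
  \<open>Euclidean_space n\<close>, so the preimage of an open neighbourhood of \<open>x\<close> is
  open and contains 0.\<close>

lemma eventually_nhdsin_ray:
  assumes ev: "\<forall>\<^sub>F y in nhdsin (Euclidean_space n) x. Q y"
    and x: "x \<in> space_E n" and l: "l \<in> space_E n"
  shows "\<forall>\<^sub>F t in at_right 0. Q (\<lambda>i. x i + t * l i)"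
proof -
  obtain U where U: "openin (Euclidean_space n) U" "x \<in> U" "\<And>y. y \<in> U \<Longrightarrow> Q y"
    using ev x by (auto simp: eventually_nhdsin)
  \<comment> \<open>Continuity is checked coordinatewise; as \<open>x\<close> and \<open>l\<close>
    lie in the space, the coordinates from \<open>n\<close> on stay zero.\<close>
  have "continuous_map euclideanreal (Euclidean_space n) (\<lambda>t i. x i + t * l i)"
    using x l unfolding Euclidean_space_def
    by (auto simp: continuous_map_in_subtopology continuous_map_componentwise_UNIV
        intro!: continuous_intros)
  then have "open {t. (\<lambda>i. x i + t * l i) \<in> U}"
    using U(1) by (auto simp: continuous_map_def)
  then have "\<forall>\<^sub>F t in nhds 0. t \<in> {t. (\<lambda>i. x i + t * l i) \<in> U}"
    using U(2) by (intro eventually_nhds_in_open) auto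
  then show ?thesis
    using U(3) by (auto simp: eventually_at_filter elim: eventually_mono)
qed

text \<open>\<open>Lim\<close> is a definite description; it picks out the limit because limits
  along the nontrivial filter \<open>at_right 0\<close> are unique.\<close>

lemma dir_quotient_tendsto_dir_deriv:
  assumes "dir_differentiable f x l"
  shows "(dir_quotient f x l \<longlongrightarrow> dir_deriv f x l) (at_right 0)"
  using assms unfolding dir_differentiable_def dir_deriv_def
  by (metis tendsto_Lim trivial_limit_at_right_real)

text \<open>Weak inequalities pass to limits. The direction ranges over the whole space, not just
  the sphere, because slices evaluate the derivative at non-unit vectors.\<close>

lemma local_minimum_dir_deriv_nonneg:
  assumes "local_minimum n f x" "x \<in> space_E n" "l \<in> space_E n" "dir_differentiable f x l"
  shows "dir_deriv f x l \<ge> 0"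
proof (rule tendsto_lowerbound[OF dir_quotient_tendsto_dir_deriv[OF assms(4)]])
  have "\<forall>\<^sub>F t in at_right 0. f x \<le> f (\<lambda>i. x i + t * l i)"
    using assms unfolding local_minimum_def by (intro eventually_nhdsin_ray)
  then show "\<forall>\<^sub>F t in at_right 0. 0 \<le> dir_quotient f x l t"
    using eventually_at_right_less[of 0] by eventually_elim (simp add: dir_quotient_def)
qed simp

lemma local_maximum_dir_deriv_nonpos:
  assumes "local_maximum n f x" "x \<in> space_E n" "l \<in> space_E n" "dir_differentiable f x l"
  shows "dir_deriv f x l \<le> 0"
proof (rule tendsto_upperbound[OF dir_quotient_tendsto_dir_deriv[OF assms(4)]])
  have "\<forall>\<^sub>F t in at_right 0. f (\<lambda>i. x i + t * l i) \<le> f x"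
    using assms unfolding local_maximum_def by (intro eventually_nhdsin_ray)
  then show "\<forall>\<^sub>F t in at_right 0. dir_quotient f x l t \<le> 0"
    using eventually_at_right_less[of 0]
    by eventually_elim (simp add: dir_quotient_def divide_nonpos_pos)
qed simp

lemma point1_in_space_E: "point1 s \<in> space_E (Suc n)"
  by (simp add: point1_def topspace_Euclidean_space)

lemma sphere_E_subset_space_E: "l \<in> sphere_E m \<Longrightarrow> l \<in> space_E (Suc m)"
  by (simp add: nsphere topspace_Euclidean_space)

text \<open>\<open>proj_transpose\<close> is cut off to 0 beyond index \<open>m\<close>, so every
  \<open>y\<close> is covered and a slice can be bounded at all arguments at once.\<close>

lemma add_proj_transpose_in_space_E:
  "l \<in> sphere_E m \<Longrightarrow> (\<lambda>i. l i + proj_transpose P m l y i) \<in> space_E (Suc m)"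
  by (simp add: nsphere topspace_Euclidean_space proj_transpose_def)

lemma dir_slice_zero: "dir_slice P m f x l (\<lambda>i. 0) = dir_deriv f x l"
  by (simp add: dir_slice_def proj_transpose_def cong: if_cong)

text \<open>The bound \<open>M\<close> is fixed because the recursion hands the same
  \<open>M\<close> to every slice. The induction replaces \<open>f\<close> by a slice and
  \<open>x\<close> by 0; both kinds of extremum share it.\<close>

lemma directed_subdiff_local_extremum:
  assumes "directed_subdiff_bound P n M f x" "x \<in> space_E n"
  shows "(local_minimum n f x \<longrightarrow> directed_le n (directed_zero n) (directed_subdiff P n f x)) \<and>
         (local_maximum n f x \<longrightarrow>
            directed_le n (directed_zero n) (directed_uminus (directed_subdiff P n f x)))"
  using assms
proof (induction P n M f x rule: directed_subdiff_bound.induct)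
  \<comment> \<open>The order negates left endpoints, and the left endpoint here is already minus
    the derivative along -1, so only the signs of the two derivatives are asked for.\<close>
  case (2 P M f x)
  then show ?case
    using local_minimum_dir_deriv_nonneg[of "Suc 0" f x]
      local_maximum_dir_deriv_nonpos[of "Suc 0" f x] point1_in_space_E[of _ 0]
    by simp
next
  case (3 P m M f x)
  let ?E = "Euclidean_space (Suc m)"
  let ?g = "\<lambda>l. dir_slice P (Suc m) f x l"
  have diff: "dir_differentiable f x l" if "l \<in> space_E (Suc (Suc m))" for l
    using 3(2) that by simp
  have IH: "(local_minimum (Suc m) (?g l) (\<lambda>i. 0) \<longrightarrow>
        directed_le (Suc m) (directed_zero (Suc m)) (directed_subdiff P (Suc m) (?g l) (\<lambda>i. 0))) \<and>
      (local_maximum (Suc m) (?g l) (\<lambda>i. 0) \<longrightarrow> directed_le (Suc m) (directed_zero (Suc m))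
        (directed_uminus (directed_subdiff P (Suc m) (?g l) (\<lambda>i. 0))))"
    if "l \<in> sphere_E (Suc m)" for l
    using 3 that by (simp add: topspace_Euclidean_space)
  have everywhere: "\<forall>\<^sub>F y in nhdsin ?E (\<lambda>i. 0). Q y" if "\<And>y. Q y" for Q
    using that by simp
  show ?case
  proof (intro conjI impI)
    assume "local_minimum (Suc (Suc m)) f x"
    then have nonneg: "dir_deriv f x l \<ge> 0" if "l \<in> space_E (Suc (Suc m))" for l
      using local_minimum_dir_deriv_nonneg 3(3) that diff by blast
    \<comment> \<open>The order inspects lower components only where the top ones agree, so only
      directions with derivative 0 matter.\<close>
    have "local_minimum (Suc m) (?g l) (\<lambda>i. 0)"
      if "l \<in> sphere_E (Suc m)" "dir_deriv f x l = 0" for l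
      unfolding local_minimum_def dir_slice_zero that(2)
      by (rule everywhere) (simp add: dir_slice_def nonneg add_proj_transpose_in_space_E that(1))
    then show "directed_le (Suc (Suc m)) (directed_zero (Suc (Suc m)))
        (directed_subdiff P (Suc (Suc m)) f x)"
      using IH nonneg sphere_E_subset_space_E by simp
  next
    assume "local_maximum (Suc (Suc m)) f x"
    then have nonpos: "dir_deriv f x l \<le> 0" if "l \<in> space_E (Suc (Suc m))" for l
      using local_maximum_dir_deriv_nonpos 3(3) that diff by blast
    have "local_maximum (Suc m) (?g l) (\<lambda>i. 0)"
      if "l \<in> sphere_E (Suc m)" "dir_deriv f x l = 0" for l
      unfolding local_maximum_def dir_slice_zero that(2)
      by (rule everywhere) (simp add: dir_slice_def nonpos add_proj_transpose_in_space_E that(1))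
    \<comment> \<open>Negation is componentwise: a tie with 0 again means derivative 0, and the
      negated lower component is the one in \<open>IH\<close>.\<close>
    then show "directed_le (Suc (Suc m)) (directed_zero (Suc (Suc m)))
        (directed_uminus (directed_subdiff P (Suc (Suc m)) f x))"
      using IH nonpos sphere_E_subset_space_E by simp
  qed
qed simp

theorem proposition3p5:
  fixes P :: "nat \<Rightarrow> (nat \<Rightarrow> real) \<Rightarrow> (nat \<Rightarrow> real) \<Rightarrow> (nat \<Rightarrow> real)"
    and n :: nat
    and f :: "(nat \<Rightarrow> real) \<Rightarrow> real"
    and x :: "nat \<Rightarrow> real"
  assumes "projection_family P"
    and "n \<ge> 1"
    and "x \<in> topspace (Euclidean_space n)"
    and "directed_subdifferentiable P n f x"
  shows "(local_minimum n f x \<longrightarrow> directed_le n (directed_zero n) (directed_subdiff P n f x)) \<and>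
         (local_maximum n f x \<longrightarrow>
            directed_le n (directed_zero n) (directed_uminus (directed_subdiff P n f x)))"
proof -
  obtain M where "directed_subdiff_bound P n M f x"
    using assms(4) unfolding directed_subdifferentiable_def by blast
  then show ?thesis
    using assms(3) by (rule directed_subdiff_local_extremum)
qed

end
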